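(* Let $R$ be a commutative ring. Let $j$ be an element of the Jacobson radical of $R$. Let $W$ be the multiplicative set generated by $j$ and the units of $R$. Then $R$ is $W$-Egyptian.
   Context: Rings are commutative with identity. A multiplicative set in a ring $R$ is a subset containing $1$ and closed under multiplication ($0$ is allowed to belong to it); the multiplicative set generated by a subset is the smallest multiplicative set containing it. For a multiplicative set $W\subseteq R$, $W^{-1}R$ denotes the localization. An element $c\in W^{-1}R$ is called $W$-Egyptian if it can be written as a finite (possibly empty) sum of reciprocals $\frac{1}{w_1}+\cdots+\frac{1}{w_n}$ in $W^{-1}R$ with all $w_i\in W$ (repetitions allowed). An element $b\in R$ is $W$-Egyptian if $\frac{b}{1}\in W^{-1}R$ is. The ring $R$ is $W$-Egyptian if every nonzero element of $R$ is $W$-Egyptian. *)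

theory Defs
  imports "HOL-Algebra.QuotRing"
begin

section \<open>Multiplicative sets and the Jacobson radical\<close>

text \<open>
  A multiplicative set of \<open>R\<close> is a \<^const>\<open>submonoid\<close> of (the multiplicative monoid of) \<open>R\<close>.
  Nothing excludes \<open>\<zero>\<close>.
\<close>

definition mult_set_generated :: "('a, 'b) ring_scheme \<Rightarrow> 'a set \<Rightarrow> 'a set"
  where "mult_set_generated R A = \<Inter>{W. submonoid W R \<and> A \<subseteq> W}"

text \<open>
  The zero ring has no maximal ideals; the intersection is taken inside \<open>carrier R\<close>, so that its
  Jacobson radical is the whole ring.
\<close>

definition jacobson_radical :: "('a, 'b) ring_scheme \<Rightarrow> 'a set"
  where "jacobson_radical R = carrier R \<inter> \<Inter>{M. maximalideal M R}"

lemma mult_set_generated_submonoid: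
  assumes "monoid R" "A \<subseteq> carrier R"
  shows "submonoid (mult_set_generated R A) R"
proof -
  interpret monoid R by fact
  have "submonoid (carrier R) R"
    by unfold_locales auto
  then show ?thesis
    using assms(2) unfolding mult_set_generated_def
    by unfold_locales (auto intro: submonoid.m_closed submonoid.one_closed)
qed

section \<open>Localization\<close>

definition loc_rel :: "('a, 'b) ring_scheme \<Rightarrow> 'a set \<Rightarrow> (('a \<times> 'a) \<times> ('a \<times> 'a)) set"
  where "loc_rel R W = {((a, s), (b, t)). a \<in> carrier R \<and> s \<in> W \<and> b \<in> carrier R \<and> t \<in> W \<and>
    (\<exists>u\<in>W. u \<otimes>\<^bsub>R\<^esub> (a \<otimes>\<^bsub>R\<^esub> t) = u \<otimes>\<^bsub>R\<^esub> (b \<otimes>\<^bsub>R\<^esub> s))}"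

text \<open>\<open>loc_frac R W a s\<close> is the fraction \<open>a / s\<close> in \<open>W\<^sup>-\<^sup>1R\<close>.\<close>

definition loc_frac :: "('a, 'b) ring_scheme \<Rightarrow> 'a set \<Rightarrow> 'a \<Rightarrow> 'a \<Rightarrow> ('a \<times> 'a) set"
  where "loc_frac R W a s = loc_rel R W `` {(a, s)}"

text \<open>
  The unions below range over all representatives of the two classes; they are unions of a single
  class, see \<open>loc_frac_add\<close> and \<open>loc_frac_mult\<close>.
\<close>

definition localization :: "('a, 'b) ring_scheme \<Rightarrow> 'a set \<Rightarrow> ('a \<times> 'a) set ring"
  where "localization R W =
   \<lparr>carrier = (carrier R \<times> W) // loc_rel R W,
    mult = (\<lambda>X Y. \<Union>(a, s)\<in>X. \<Union>(b, t)\<in>Y. loc_frac R W (a \<otimes>\<^bsub>R\<^esub> b) (s \<otimes>\<^bsub>R\<^esub> t)),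
    one = loc_frac R W \<one>\<^bsub>R\<^esub> \<one>\<^bsub>R\<^esub>,
    zero = loc_frac R W \<zero>\<^bsub>R\<^esub> \<one>\<^bsub>R\<^esub>,
    add = (\<lambda>X Y. \<Union>(a, s)\<in>X. \<Union>(b, t)\<in>Y.
      loc_frac R W (a \<otimes>\<^bsub>R\<^esub> t \<oplus>\<^bsub>R\<^esub> b \<otimes>\<^bsub>R\<^esub> s) (s \<otimes>\<^bsub>R\<^esub> t))\<rparr>"

locale mult_set = cring R + submonoid W R for R (structure) and W
begin

lemma W_carrier [simp, intro]: "s \<in> W \<Longrightarrow> s \<in> carrier R"
  using subset by blast

lemma equiv_loc_rel: "equiv (carrier R \<times> W) (loc_rel R W)"
proof (rule equivI)
  show "loc_rel R W \<subseteq> (carrier R \<times> W) \<times> carrier R \<times> W"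
    by (auto simp: loc_rel_def)
  show "refl_on (carrier R \<times> W) (loc_rel R W)"
    using one_closed by (auto simp: loc_rel_def refl_on_def)
  show "sym (loc_rel R W)"
    unfolding sym_def loc_rel_def by (auto dest: sym)
  show "trans (loc_rel R W)"
  proof (rule transI)
    fix x y z assume xy: "(x, y) \<in> loc_rel R W" and yz: "(y, z) \<in> loc_rel R W"
    obtain a s b t c r where eq: "x = (a, s)" "y = (b, t)" "z = (c, r)"
      by (metis surj_pair)
    from xy yz obtain u v where W: "u \<in> W" "v \<in> W" "s \<in> W" "t \<in> W" "r \<in> W"
      and C: "a \<in> carrier R" "b \<in> carrier R" "c \<in> carrier R"
      and u: "u \<otimes> (a \<otimes> t) = u \<otimes> (b \<otimes> s)" and v: "v \<otimes> (b \<otimes> r) = v \<otimes> (c \<otimes> t)"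
      by (auto simp: loc_rel_def eq)
    have "(u \<otimes> v \<otimes> t) \<otimes> (a \<otimes> r) = (u \<otimes> (a \<otimes> t)) \<otimes> (v \<otimes> r)"
      using W C by (simp add: m_ac)
    also have "\<dots> = (v \<otimes> (b \<otimes> r)) \<otimes> (u \<otimes> s)"
      unfolding u using W C by (simp add: m_ac)
    also have "\<dots> = (u \<otimes> v \<otimes> t) \<otimes> (c \<otimes> s)"
      unfolding v using W C by (simp add: m_ac)
    finally have "(u \<otimes> v \<otimes> t) \<otimes> (a \<otimes> r) = (u \<otimes> v \<otimes> t) \<otimes> (c \<otimes> s)" .
    moreover have "u \<otimes> v \<otimes> t \<in> W" using W by simp
    ultimately show "(x, z) \<in> loc_rel R W"
      unfolding loc_rel_def eq using W C by blast
  qed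
qed

lemma loc_frac_eq_iff:
  assumes "a \<in> carrier R" "b \<in> carrier R" "s \<in> W" "t \<in> W"
  shows "loc_frac R W a s = loc_frac R W b t \<longleftrightarrow> (\<exists>u\<in>W. u \<otimes> (a \<otimes> t) = u \<otimes> (b \<otimes> s))"
proof -
  have "loc_frac R W a s = loc_frac R W b t \<longleftrightarrow> ((a, s), (b, t)) \<in> loc_rel R W"
    unfolding loc_frac_def using assms by (intro eq_equiv_class_iff[OF equiv_loc_rel]) auto
  then show ?thesis
    using assms by (simp add: loc_rel_def)
qed

lemma loc_frac_eqI:
  assumes "a \<in> carrier R" "b \<in> carrier R" "s \<in> W" "t \<in> W" "a \<otimes> t = b \<otimes> s"
  shows "loc_frac R W a s = loc_frac R W b t"
  using assms loc_frac_eq_iff one_closed by auto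

lemma loc_frac_closed [simp, intro]:
  "a \<in> carrier R \<Longrightarrow> s \<in> W \<Longrightarrow> loc_frac R W a s \<in> carrier (localization R W)"
  by (auto simp: localization_def loc_frac_def intro!: quotientI)

lemma localization_cases:
  assumes "X \<in> carrier (localization R W)"
  obtains a s where "a \<in> carrier R" "s \<in> W" "X = loc_frac R W a s"
  using assms by (auto simp: localization_def loc_frac_def elim!: quotientE)

lemma loc_rel_mult:
  "(\<lambda>(a, s) (b, t). loc_frac R W (a \<otimes> b) (s \<otimes> t)) respects2 loc_rel R W"
proof (rule congruent2_commuteI[OF equiv_loc_rel])
  fix y z assume "y \<in> carrier R \<times> W" "z \<in> carrier R \<times> W"
  then show "(case y of (a, s) \<Rightarrow> \<lambda>(b, t). loc_frac R W (a \<otimes> b) (s \<otimes> t)) z =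
    (case z of (a, s) \<Rightarrow> \<lambda>(b, t). loc_frac R W (a \<otimes> b) (s \<otimes> t)) y"
    by (auto simp: m_comm)
next
  fix y z w assume A: "w \<in> carrier R \<times> W" "(y, z) \<in> loc_rel R W"
  obtain a s b t c r where eq: "y = (a, s)" "z = (b, t)" "w = (c, r)"
    by (metis surj_pair)
  from A obtain u where W: "u \<in> W" "s \<in> W" "t \<in> W" "r \<in> W"
    and C: "a \<in> carrier R" "b \<in> carrier R" "c \<in> carrier R"
    and u: "u \<otimes> (a \<otimes> t) = u \<otimes> (b \<otimes> s)"
    by (auto simp: loc_rel_def eq)
  have "u \<otimes> ((c \<otimes> a) \<otimes> (r \<otimes> t)) = (u \<otimes> (a \<otimes> t)) \<otimes> (c \<otimes> r)"
    using W C by (simp add: m_ac)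
  also have "\<dots> = u \<otimes> ((c \<otimes> b) \<otimes> (r \<otimes> s))"
    unfolding u using W C by (simp add: m_ac)
  finally have "loc_frac R W (c \<otimes> a) (r \<otimes> s) = loc_frac R W (c \<otimes> b) (r \<otimes> t)"
    using W C by (subst loc_frac_eq_iff) auto
  then show "(case w of (a, s) \<Rightarrow> \<lambda>(b, t). loc_frac R W (a \<otimes> b) (s \<otimes> t)) y =
    (case w of (a, s) \<Rightarrow> \<lambda>(b, t). loc_frac R W (a \<otimes> b) (s \<otimes> t)) z"
    by (simp add: eq)
qed

lemma loc_rel_add:
  "(\<lambda>(a, s) (b, t). loc_frac R W (a \<otimes> t \<oplus> b \<otimes> s) (s \<otimes> t)) respects2 loc_rel R W"
proof (rule congruent2_commuteI[OF equiv_loc_rel])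
  fix y z assume "y \<in> carrier R \<times> W" "z \<in> carrier R \<times> W"
  then show "(case y of (a, s) \<Rightarrow> \<lambda>(b, t). loc_frac R W (a \<otimes> t \<oplus> b \<otimes> s) (s \<otimes> t)) z =
    (case z of (a, s) \<Rightarrow> \<lambda>(b, t). loc_frac R W (a \<otimes> t \<oplus> b \<otimes> s) (s \<otimes> t)) y"
    by (auto simp: m_comm a_comm)
next
  fix y z w assume A: "w \<in> carrier R \<times> W" "(y, z) \<in> loc_rel R W"
  obtain a s b t c r where eq: "y = (a, s)" "z = (b, t)" "w = (c, r)"
    by (metis surj_pair)
  from A obtain u where W: "u \<in> W" "s \<in> W" "t \<in> W" "r \<in> W"
    and C: "a \<in> carrier R" "b \<in> carrier R" "c \<in> carrier R"
    and u: "u \<otimes> (a \<otimes> t) = u \<otimes> (b \<otimes> s)"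
    by (auto simp: loc_rel_def eq)
  have "u \<otimes> ((c \<otimes> s \<oplus> a \<otimes> r) \<otimes> (r \<otimes> t)) =
      u \<otimes> (c \<otimes> s \<otimes> r \<otimes> t) \<oplus> (u \<otimes> (a \<otimes> t)) \<otimes> (r \<otimes> r)"
    using W C by (simp add: m_ac l_distr r_distr)
  also have "\<dots> = u \<otimes> ((c \<otimes> t \<oplus> b \<otimes> r) \<otimes> (r \<otimes> s))"
    unfolding u using W C by (simp add: m_ac l_distr r_distr)
  finally have "loc_frac R W (c \<otimes> s \<oplus> a \<otimes> r) (r \<otimes> s) = loc_frac R W (c \<otimes> t \<oplus> b \<otimes> r) (r \<otimes> t)"
    using W C by (subst loc_frac_eq_iff) auto
  then show "(case w of (a, s) \<Rightarrow> \<lambda>(b, t). loc_frac R W (a \<otimes> t \<oplus> b \<otimes> s) (s \<otimes> t)) y =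
    (case w of (a, s) \<Rightarrow> \<lambda>(b, t). loc_frac R W (a \<otimes> t \<oplus> b \<otimes> s) (s \<otimes> t)) z"
    by (simp add: eq)
qed

lemma loc_frac_mult:
  assumes "a \<in> carrier R" "b \<in> carrier R" "s \<in> W" "t \<in> W"
  shows "loc_frac R W a s \<otimes>\<^bsub>localization R W\<^esub> loc_frac R W b t = loc_frac R W (a \<otimes> b) (s \<otimes> t)"
proof -
  have "loc_frac R W a s \<otimes>\<^bsub>localization R W\<^esub> loc_frac R W b t =
    (\<Union>x\<in>loc_rel R W `` {(a, s)}. \<Union>y\<in>loc_rel R W `` {(b, t)}.
      (\<lambda>(a, s) (b, t). loc_frac R W (a \<otimes> b) (s \<otimes> t)) x y)"
    by (simp add: localization_def loc_frac_def split_def)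
  also have "\<dots> = (\<lambda>(a, s) (b, t). loc_frac R W (a \<otimes> b) (s \<otimes> t)) (a, s) (b, t)"
    using assms by (intro UN_equiv_class2[OF equiv_loc_rel equiv_loc_rel loc_rel_mult]) auto
  finally show ?thesis by simp
qed

lemma loc_frac_add:
  assumes "a \<in> carrier R" "b \<in> carrier R" "s \<in> W" "t \<in> W"
  shows "loc_frac R W a s \<oplus>\<^bsub>localization R W\<^esub> loc_frac R W b t =
    loc_frac R W (a \<otimes> t \<oplus> b \<otimes> s) (s \<otimes> t)"
proof -
  have "loc_frac R W a s \<oplus>\<^bsub>localization R W\<^esub> loc_frac R W b t =
    (\<Union>x\<in>loc_rel R W `` {(a, s)}. \<Union>y\<in>loc_rel R W `` {(b, t)}.
      (\<lambda>(a, s) (b, t). loc_frac R W (a \<otimes> t \<oplus> b \<otimes> s) (s \<otimes> t)) x y)"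
    by (simp add: localization_def loc_frac_def split_def)
  also have "\<dots> = (\<lambda>(a, s) (b, t). loc_frac R W (a \<otimes> t \<oplus> b \<otimes> s) (s \<otimes> t)) (a, s) (b, t)"
    using assms by (intro UN_equiv_class2[OF equiv_loc_rel equiv_loc_rel loc_rel_add]) auto
  finally show ?thesis by simp
qed

lemma localization_one: "\<one>\<^bsub>localization R W\<^esub> = loc_frac R W \<one> \<one>"
  and localization_zero: "\<zero>\<^bsub>localization R W\<^esub> = loc_frac R W \<zero> \<one>"
  by (simp_all add: localization_def)

theorem localization_cring: "cring (localization R W)"
proof (rule cringI)
  show "abelian_group (localization R W)"
  proof (rule abelian_groupI)
    fix X Y assume "X \<in> carrier (localization R W)" "Y \<in> carrier (localization R W)"
    then show "X \<oplus>\<^bsub>localization R W\<^esub> Y \<in> carrier (localization R W)"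
      by (auto elim!: localization_cases simp: loc_frac_add)
  next
    show "\<zero>\<^bsub>localization R W\<^esub> \<in> carrier (localization R W)"
      by (simp add: localization_zero one_closed)
  next
    fix X Y Z assume "X \<in> carrier (localization R W)" "Y \<in> carrier (localization R W)"
      "Z \<in> carrier (localization R W)"
    then show "X \<oplus>\<^bsub>localization R W\<^esub> Y \<oplus>\<^bsub>localization R W\<^esub> Z =
      X \<oplus>\<^bsub>localization R W\<^esub> (Y \<oplus>\<^bsub>localization R W\<^esub> Z)"
      by (auto elim!: localization_cases simp: loc_frac_add m_ac a_ac l_distr r_distr)
  next
    fix X Y assume "X \<in> carrier (localization R W)" "Y \<in> carrier (localization R W)"
    then show "X \<oplus>\<^bsub>localization R W\<^esub> Y = Y \<oplus>\<^bsub>localization R W\<^esub> X"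
      by (auto elim!: localization_cases simp: loc_frac_add m_comm a_comm)
  next
    fix X assume "X \<in> carrier (localization R W)"
    then show "\<zero>\<^bsub>localization R W\<^esub> \<oplus>\<^bsub>localization R W\<^esub> X = X"
      by (auto elim!: localization_cases simp: loc_frac_add localization_zero one_closed)
  next
    fix X assume "X \<in> carrier (localization R W)"
    then obtain a s where X: "a \<in> carrier R" "s \<in> W" "X = loc_frac R W a s"
      by (rule localization_cases)
    have "loc_frac R W (\<ominus> a) s \<oplus>\<^bsub>localization R W\<^esub> X = \<zero>\<^bsub>localization R W\<^esub>"
      using X by (simp add: loc_frac_add localization_zero one_closed)
        (rule loc_frac_eqI, auto simp: l_minus l_neg one_closed)
    then show "\<exists>Y\<in>carrier (localization R W). Y \<oplus>\<^bsub>localization R W\<^esub> X = \<zero>\<^bsub>localization R W\<^esub>"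
      using X by auto
  qed
next
  show "comm_monoid (localization R W)"
    by (rule comm_monoidI)
      (auto elim!: localization_cases simp: loc_frac_mult localization_one one_closed m_ac)
next
  fix X Y Z assume "X \<in> carrier (localization R W)" "Y \<in> carrier (localization R W)"
    "Z \<in> carrier (localization R W)"
  then obtain a s b t c r where W: "s \<in> W" "t \<in> W" "r \<in> W"
    and C: "a \<in> carrier R" "b \<in> carrier R" "c \<in> carrier R"
    and eq: "X = loc_frac R W a s" "Y = loc_frac R W b t" "Z = loc_frac R W c r"
    by (metis localization_cases)
  have "loc_frac R W ((a \<otimes> t \<oplus> b \<otimes> s) \<otimes> c) (s \<otimes> t \<otimes> r) =
    loc_frac R W (a \<otimes> c \<otimes> (t \<otimes> r) \<oplus> b \<otimes> c \<otimes> (s \<otimes> r)) (s \<otimes> r \<otimes> (t \<otimes> r))"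
    using W C by (intro loc_frac_eqI) (auto simp: m_ac l_distr r_distr)
  then show "(X \<oplus>\<^bsub>localization R W\<^esub> Y) \<otimes>\<^bsub>localization R W\<^esub> Z =
    X \<otimes>\<^bsub>localization R W\<^esub> Z \<oplus>\<^bsub>localization R W\<^esub> Y \<otimes>\<^bsub>localization R W\<^esub> Z"
    using W C by (simp add: eq loc_frac_add loc_frac_mult)
qed

lemma localization_hom: "(\<lambda>a. loc_frac R W a \<one>) \<in> ring_hom R (localization R W)"
  by (rule ring_hom_memI) (auto simp: loc_frac_add loc_frac_mult localization_one one_closed)

lemma loc_frac_reciprocal:
  assumes "w \<in> W"
  shows "loc_frac R W w \<one> \<in> Units (localization R W)"
    and "inv\<^bsub>localization R W\<^esub> (loc_frac R W w \<one>) = loc_frac R W \<one> w"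
proof -
  interpret L: cring "localization R W" by (rule localization_cring)
  have *: "loc_frac R W w \<one> \<otimes>\<^bsub>localization R W\<^esub> loc_frac R W \<one> w = \<one>\<^bsub>localization R W\<^esub>"
    using assms by (simp add: loc_frac_mult localization_one one_closed) (rule loc_frac_eqI, auto simp: one_closed)
  have c: "loc_frac R W w \<one> \<in> carrier (localization R W)" "loc_frac R W \<one> w \<in> carrier (localization R W)"
    using assms by (auto simp: one_closed)
  show "loc_frac R W w \<one> \<in> Units (localization R W)"
    using * c L.m_comm[OF c] by (auto simp: Units_def)
  show "inv\<^bsub>localization R W\<^esub> (loc_frac R W w \<one>) = loc_frac R W \<one> w"
    using L.comm_inv_char[OF c *] .
qed

end

section \<open>Egyptian elements and rings\<close>

definition egyptian_fraction :: "('a, 'b) ring_scheme \<Rightarrow> 'a set \<Rightarrow> ('a \<times> 'a) set \<Rightarrow> bool"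
  where "egyptian_fraction R W c \<longleftrightarrow>
    (\<exists>(n::nat) w. (\<forall>i<n. w i \<in> W) \<and> c = (\<Oplus>\<^bsub>localization R W\<^esub>i\<in>{..<n}. loc_frac R W \<one>\<^bsub>R\<^esub> (w i)))"

definition egyptian_element :: "('a, 'b) ring_scheme \<Rightarrow> 'a set \<Rightarrow> 'a \<Rightarrow> bool"
  where "egyptian_element R W b \<longleftrightarrow> egyptian_fraction R W (loc_frac R W b \<one>\<^bsub>R\<^esub>)"

definition egyptian_ring :: "('a, 'b) ring_scheme \<Rightarrow> 'a set \<Rightarrow> bool"
  where "egyptian_ring R W \<longleftrightarrow> (\<forall>b\<in>carrier R - {\<zero>\<^bsub>R\<^esub>}. egyptian_element R W b)"

end

theory Submission
  imports Defs "HOL-Algebra.Ring_Divisibility"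
begin

text \<open>
  For \<open>b \<in> R\<close> the element \<open>u = j b - 1\<close> is a unit, because \<open>j\<close> lies in the Jacobson radical.
  Dividing \<open>j b = 1 + u\<close> by \<open>j\<close> gives \<open>b = 1 / j + 1 / (j u\<^sup>-\<^sup>1)\<close>, a sum of two reciprocals.
\<close>

text \<open>Zorn's lemma applies to the ideals that contain \<open>I\<close> and avoid
  \<open>\<one>\<close>: the union of a nonempty chain of them is again one. An ideal is proper
  exactly when it avoids \<open>\<one>\<close>, so a maximal member of this family is a maximal
  ideal.\<close>

lemma (in ring) proper_ideal_subset_maximalideal:
  assumes "ideal I R" "\<one> \<notin> I"
  obtains M where "maximalideal M R" "I \<subseteq> M"
proof -
  let ?A = "{J. ideal J R \<and> I \<subseteq> J \<and> \<one> \<notin> J}"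
  have "\<exists>M\<in>?A. \<forall>J\<in>?A. M \<subseteq> J \<longrightarrow> J = M"
  proof (rule subset_Zorn_nonempty)
    show "?A \<noteq> {}"
      using assms by blast
  next
    fix C assume C: "C \<noteq> {}" "subset.chain ?A C"
    then have "C \<subseteq> ?A" "subset.chain {J. ideal J R} C"
      unfolding subset_chain_def by blast+
    moreover have "ideal (\<Union>C) R"
      using chain_Union_is_ideal[OF calculation(2)] C(1) by simp
    ultimately show "\<Union>C \<in> ?A"
      using C(1) by blast
  qed
  then obtain M where "M \<in> ?A" and max: "\<forall>J\<in>?A. M \<subseteq> J \<longrightarrow> J = M" ..
  then have M: "ideal M R" "I \<subseteq> M" "\<one> \<notin> M"
    by simp_all
  have "maximalideal M R"
  proof (rule maximalidealI)
    show "carrier R \<noteq> M"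
      using M(3) one_closed by metis
    show "J = M \<or> J = carrier R" if "ideal J R" "M \<subseteq> J" for J
    proof (cases "\<one> \<in> J")
      case True
      then show ?thesis
        using ideal.one_imp_carrier[OF that(1)] by simp
    next
      case False
      with that M(2) have "J \<in> ?A"
        by simp
      with max that(2) show ?thesis
        by simp
    qed
  qed (fact M(1))
  from that[OF this M(2)] show thesis .
qed

text \<open>The principal ideal of a nonunit avoids \<open>\<one>\<close>, since
  \<open>\<one> = y \<otimes> x\<close> would make \<open>x\<close> invertible.\<close>

lemma (in cring) nonunit_in_maximalideal:
  assumes "x \<in> carrier R" "x \<notin> Units R"
  obtains M where "maximalideal M R" "x \<in> M"
proof -
  have "\<one> \<notin> PIdl x"
  proof
    assume "\<one> \<in> PIdl x"
    then obtain y where "y \<in> carrier R" "y \<otimes> x = \<one>"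
      by (auto simp: cgenideal_def)
    then have "x \<in> Units R"
      using assms(1) m_comm[of x y] unfolding Units_def by auto
    with assms(2) show False ..
  qed
  with cgenideal_ideal[OF assms(1)] obtain M where "maximalideal M R" "PIdl x \<subseteq> M"
    by (rule proper_ideal_subset_maximalideal)
  then show thesis
    using that cgenideal_self[OF assms(1)] by blast
qed

text \<open>A nonunit would lie in some maximal ideal \<open>M\<close>. As \<open>j\<close> lies in
  \<open>M\<close> too, so does \<open>j \<otimes> b\<close>, and the difference of the two elements
  is \<open>\<one>\<close>.\<close>

lemma (in cring) jacobson_radical_minus_one_unit:
  assumes "j \<in> jacobson_radical R" "b \<in> carrier R"
  shows "j \<otimes> b \<ominus> \<one> \<in> Units R"
proof (rule ccontr)
  have j: "j \<in> carrier R" "\<And>M. maximalideal M R \<Longrightarrow> j \<in> M"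
    using assms(1) by (auto simp: jacobson_radical_def)
  assume "j \<otimes> b \<ominus> \<one> \<notin> Units R"
  moreover have "j \<otimes> b \<ominus> \<one> \<in> carrier R"
    using j(1) assms(2) by simp
  ultimately obtain M where M: "maximalideal M R" "j \<otimes> b \<ominus> \<one> \<in> M"
    using nonunit_in_maximalideal by blast
  then interpret maximalideal M R
    by simp
  have "j \<otimes> b \<in> M"
    using I_r_closed j(2)[OF M(1)] assms(2) by blast
  then have "j \<otimes> b \<oplus> \<ominus> (j \<otimes> b \<ominus> \<one>) \<in> M"
    using M(2) by (intro a_closed a_inv_closed)
  also have "j \<otimes> b \<oplus> \<ominus> (j \<otimes> b \<ominus> \<one>) = \<one>"
    using j(1) assms(2) by (simp add: a_minus_def minus_add r_neg2)
  finally show False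
    using one_imp_carrier I_notcarr by blast
qed

lemma (in mult_set) egyptian_fraction_add_reciprocals:
  assumes "s \<in> W" "t \<in> W"
  shows "egyptian_fraction R W (loc_frac R W \<one> s \<oplus>\<^bsub>localization R W\<^esub> loc_frac R W \<one> t)"
proof -
  interpret L: cring "localization R W"
    by (rule localization_cring)
  \<comment> \<open>The sum over \<open>{..<2}\<close> unfolds from the largest index down, so index
    1 carries \<open>s\<close>, the first summand.\<close>
  let ?w = "\<lambda>i::nat. if i = 0 then t else s"
  have "(\<Oplus>\<^bsub>localization R W\<^esub>i\<in>{..<2}. loc_frac R W \<one> (?w i)) =
    loc_frac R W \<one> s \<oplus>\<^bsub>localization R W\<^esub> loc_frac R W \<one> t"
    using assms by (simp add: numeral_2_eq_2 lessThan_Suc Pi_def)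
  then show ?thesis
    unfolding egyptian_fraction_def using assms by (intro exI[of _ 2] exI[of _ ?w]) auto
qed

lemma (in mult_set) egyptian_element_if_jacobson_radical:
  assumes "j \<in> jacobson_radical R" "j \<in> W" "Units R \<subseteq> W" and b: "b \<in> carrier R"
  shows "egyptian_element R W b"
proof -
  define u where "u = j \<otimes> b \<ominus> \<one>"
  have u: "u \<in> Units R"
    unfolding u_def using jacobson_radical_minus_one_unit assms(1) b .
  \<comment> \<open>The summand \<open>u / j\<close> has to become a reciprocal: it equals
    \<open>1 / (j \<otimes> v)\<close>, and this denominator lies in \<open>W\<close> because
    \<open>v\<close> is a unit.\<close>
  define v where "v = inv u"
  have v: "v \<in> Units R" "v \<in> carrier R" "u \<otimes> v = \<one>"
    using u by (simp_all add: v_def)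
  have mem: "j \<in> W" "j \<otimes> v \<in> W"
    using assms v(1) by auto
  have j: "j \<in> carrier R"
    using assms(2) by blast
  have "j \<otimes> b = u \<oplus> \<one>"
    unfolding u_def using j b by (simp add: a_minus_def a_assoc l_neg)
  then have jbv: "j \<otimes> b \<otimes> v = \<one> \<oplus> v"
    using u v by (simp add: l_distr Units_closed)
  \<comment> \<open>The equality of fractions is cleared of denominators and holds already in
    \<open>R\<close>, so it makes no difference whether \<open>j\<close> is a zero divisor.\<close>
  have "b \<otimes> (j \<otimes> (j \<otimes> v)) = j \<otimes> (j \<otimes> b \<otimes> v)"
    using j b v(2) by (simp add: m_ac)
  \<comment> \<open>The factors \<open>\<one>\<close> stay unsimplified: the numerator then has
    exactly the form that \<open>loc_frac_add\<close> gives for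
    \<open>1 / j + 1 / (j \<otimes> v)\<close>.\<close>
  also have "\<dots> = (\<one> \<otimes> (j \<otimes> v) \<oplus> \<one> \<otimes> j) \<otimes> \<one>"
    unfolding jbv using j v(2) by (simp add: r_distr a_comm)
  finally have "loc_frac R W b \<one> = loc_frac R W (\<one> \<otimes> (j \<otimes> v) \<oplus> \<one> \<otimes> j) (j \<otimes> (j \<otimes> v))"
    using j b v(2) mem one_closed by (intro loc_frac_eqI) simp_all
  also have "\<dots> = loc_frac R W \<one> j \<oplus>\<^bsub>localization R W\<^esub> loc_frac R W \<one> (j \<otimes> v)"
    using mem by (simp only: loc_frac_add one_closed W_carrier)
  finally show ?thesis
    using egyptian_fraction_add_reciprocals[OF mem] by (simp add: egyptian_element_def)
qed

theorem proposition2p6: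
  fixes R :: "('a, 'b) ring_scheme" and j :: 'a and W :: "'a set"
  assumes "cring R"
    and "j \<in> jacobson_radical R"
    and "W = mult_set_generated R (insert j (Units R))"
  shows "egyptian_ring R W"
proof -
  interpret cring R by fact
  have "j \<in> carrier R"
    using assms(2) by (simp add: jacobson_radical_def)
  then have "submonoid W R"
    unfolding assms(3) by (intro mult_set_generated_submonoid) (auto simp: is_monoid)
  then interpret mult_set R W
    by (intro mult_set.intro is_cring)
  have "insert j (Units R) \<subseteq> W"
    unfolding assms(3) mult_set_generated_def by blast
  then show ?thesis
    using egyptian_element_if_jacobson_radical assms(2) by (simp add: egyptian_ring_def)
qed

end
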